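(* There exists a positive constant $C$ such that for every triangle-free graph $G$ with maximum degree $\Delta \geq 2$, $$\chi_c(G) \leq C\,\frac{\Delta}{\ln \Delta},$$ where $\chi_c(G)$ is the correspondence chromatic number of $G$.
   Context: All graphs are finite, undirected, and simple. A cover of a graph $G$ is a pair $(L,H)$, where $L$ assigns pairwise disjoint sets $L(v)$ to the vertices $v \in V(G)$ and $H$ is a graph with vertex set $\bigcup_{v \in V(G)} L(v)$ such that: (1) if $xy \in E(H)$ with $x \in L(u)$, $y \in L(v)$, then $uv \in E(G)$ (in particular $u \neq v$); (2) for each $uv \in E(G)$, the edges of $H$ between $L(u)$ and $L(v)$ form a matching (not necessarily perfect, possibly empty). An $(L,H)$-coloring of $G$ is an independent set $I \subseteq V(H)$ in $H$ such that $I \cap L(v) \neq \emptyset$ for all $v \in V(G)$. $G$ is $(L,H)$-colorable if it admits an $(L,H)$-coloring. $G$ is $k$-correspondence-colorable if it is $(L,H)$-colorable for every cover $(L,H)$ of $G$ with $|L(v)| \geq k$ for all $v \in V(G)$. The correspondence chromatic number $\chi_c(G)$ is the least $k$ such that $G$ is $k$-correspondence-colorable. *)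

theory Defs
  imports Complex_Main "HOL-Library.Disjoint_Sets" "Graph_Theory.Pair_Digraph"
begin

text \<open>
  Finite simple undirected graphs are the graphs \<open>G\<close> with \<open>pair_graph G\<close>: finite, loop-free,
  with a symmetric arc relation; an undirected edge \<open>uv\<close> is the pair of arcs \<open>(u, v)\<close>, \<open>(v, u)\<close>.
  Hence the degree of a vertex is its \<open>out_degree\<close>.
\<close>

text \<open>Inserting \<open>0\<close> only matters for the graph without vertices.\<close>

definition max_degree :: "'a pair_pre_digraph \<Rightarrow> nat" where
  "max_degree G = Max (insert 0 ((\<lambda>v. out_degree (with_proj G) v) ` pverts G))"

definition triangle_free :: "'a pair_pre_digraph \<Rightarrow> bool" where
  "triangle_free G \<longleftrightarrow>
     \<not> (\<exists>u v w. (u, v) \<in> parcs G \<and> (v, w) \<in> parcs G \<and> (w, u) \<in> parcs G)"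

definition independent_set :: "'a pair_pre_digraph \<Rightarrow> 'a set \<Rightarrow> bool" where
  "independent_set G I \<longleftrightarrow> I \<subseteq> pverts G \<and> (\<forall>x\<in>I. \<forall>y\<in>I. (x, y) \<notin> parcs G)"

text \<open>
  The edges between two disjoint sets \<open>A\<close> and \<open>B\<close>, each oriented from \<open>A\<close> to \<open>B\<close>, form a
  matching iff distinct ones differ in both their endpoint in \<open>A\<close> and their endpoint in \<open>B\<close>.
\<close>

definition matching_between :: "'a pair_pre_digraph \<Rightarrow> 'a set \<Rightarrow> 'a set \<Rightarrow> bool" where
  "matching_between H A B \<longleftrightarrow>
     inj_on fst (parcs H \<inter> A \<times> B) \<and> inj_on snd (parcs H \<inter> A \<times> B)"

definition cover :: "'a pair_pre_digraph \<Rightarrow> ('a \<Rightarrow> 'b set) \<Rightarrow> 'b pair_pre_digraph \<Rightarrow> bool" where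
  "cover G L H \<longleftrightarrow>
     disjoint_family_on L (pverts G) \<and>
     pair_graph H \<and>
     pverts H = (\<Union>v\<in>pverts G. L v) \<and>
     (\<forall>u\<in>pverts G. \<forall>v\<in>pverts G. \<forall>x\<in>L u. \<forall>y\<in>L v. (x, y) \<in> parcs H \<longrightarrow> (u, v) \<in> parcs G) \<and>
     (\<forall>u v. (u, v) \<in> parcs G \<longrightarrow> matching_between H (L u) (L v))"

definition cover_coloring ::
  "'a pair_pre_digraph \<Rightarrow> ('a \<Rightarrow> 'b set) \<Rightarrow> 'b pair_pre_digraph \<Rightarrow> 'b set \<Rightarrow> bool" where
  "cover_coloring G L H I \<longleftrightarrow> independent_set H I \<and> (\<forall>v\<in>pverts G. I \<inter> L v \<noteq> {})"

definition cover_colorable ::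
  "'a pair_pre_digraph \<Rightarrow> ('a \<Rightarrow> 'b set) \<Rightarrow> 'b pair_pre_digraph \<Rightarrow> bool" where
  "cover_colorable G L H \<longleftrightarrow> (\<exists>I. cover_coloring G L H I)"

text \<open>
  A definition cannot quantify over the type of the vertices of \<open>H\<close>. As \<open>H\<close> is finite, it may be
  taken to live on the natural numbers; \<open>correspondence_colorable_any_type\<close> below shows that
  covers over any other type are then handled as well.
\<close>

definition correspondence_colorable :: "'a pair_pre_digraph \<Rightarrow> nat \<Rightarrow> bool" where
  "correspondence_colorable G k \<longleftrightarrow>
     (\<forall>(L :: 'a \<Rightarrow> nat set) H.
        cover G L H \<and> (\<forall>v\<in>pverts G. k \<le> card (L v)) \<longrightarrow> cover_colorable G L H)"

definition correspondence_chromatic_number :: "'a pair_pre_digraph \<Rightarrow> nat" where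
  "correspondence_chromatic_number G = (LEAST k. correspondence_colorable G k)"

lemma correspondence_colorable_any_type:
  fixes L :: "'a \<Rightarrow> 'b set"
  assumes col: "correspondence_colorable G k"
    and cov: "cover G L H" and k: "\<And>v. v \<in> pverts G \<Longrightarrow> k \<le> card (L v)"
  shows "cover_colorable G L H"
proof -
  from cov have dis: "disjoint_family_on L (pverts G)" and H: "pair_graph H"
    and V: "pverts H = (\<Union>v\<in>pverts G. L v)"
    and E: "\<And>u v x y. \<lbrakk>u \<in> pverts G; v \<in> pverts G; x \<in> L u; y \<in> L v; (x, y) \<in> parcs H\<rbrakk>
              \<Longrightarrow> (u, v) \<in> parcs G"
    and M: "\<And>u v. (u, v) \<in> parcs G \<Longrightarrow> matching_between H (L u) (L v)"
    unfolding cover_def by blast+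
  interpret H: pair_graph H by (rule H)
  have arcs: "x \<in> pverts H \<and> y \<in> pverts H" if "(x, y) \<in> parcs H" for x y
    using that H.in_arcsD1 H.in_arcsD2 by blast
  obtain f :: "'b \<Rightarrow> nat" where f: "inj_on f (pverts H)"
    using finite_imp_inj_to_nat_seg[OF H.pair_finite_verts] by blast
  have f_eq: "f x = f y \<longleftrightarrow> x = y" if "x \<in> pverts H" "y \<in> pverts H" for x y
    using f that by (auto simp: inj_on_def)
  have LV: "x \<in> pverts H" if "v \<in> pverts G" "x \<in> L v" for v x
    using that V by auto
  define H' where "H' = \<lparr>pverts = f ` pverts H, parcs = map_prod f f ` parcs H\<rparr>"
  define L' where "L' v = (if v \<in> pverts G then f ` L v else {})" for v
  have H'_iff: "(f x, f y) \<in> parcs H' \<longleftrightarrow> (x, y) \<in> parcs H"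
    if "x \<in> pverts H" "y \<in> pverts H" for x y
    using that f_eq arcs by (fastforce simp: H'_def)
  have "pair_graph H'"
  proof
    fix e assume "e \<in> parcs H'"
    then obtain x y where e: "e = (f x, f y)" "(x, y) \<in> parcs H" by (auto simp: H'_def)
    with arcs show "fst e \<in> pverts H'" "snd e \<in> pverts H'" by (auto simp: H'_def)
    show "fst e \<noteq> snd e" using e arcs[OF e(2)] f_eq H.no_loops'[OF e(2)] by auto
  next
    show "finite (pverts H')" "finite (parcs H')"
      by (auto simp: H'_def H.pair_finite_verts H.pair_finite_arcs)
    show "symmetric (with_proj H')"
      unfolding symmetric_def with_proj_simps
    proof (rule symI)
      fix a b assume "(a, b) \<in> parcs H'"
      then obtain x y where xy: "a = f x" "b = f y" "(x, y) \<in> parcs H" by (auto simp: H'_def)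
      with H'_iff[of y x] arcs[OF xy(3)] H.arcs_symmetric[OF xy(3)] show "(b, a) \<in> parcs H'"
        by simp
    qed
  qed
  moreover have "disjoint_family_on L' (pverts G)"
    unfolding disjoint_family_on_def
  proof (intro ballI impI)
    fix u v assume uv: "u \<in> pverts G" "v \<in> pverts G" "u \<noteq> v"
    then have "L u \<inter> L v = {}" using dis by (auto simp: disjoint_family_on_def)
    then show "L' u \<inter> L' v = {}" using uv f_eq LV by (fastforce simp: L'_def)
  qed
  moreover have "pverts H' = (\<Union>v\<in>pverts G. L' v)"
    by (auto simp: H'_def L'_def V)
  moreover have "(u, v) \<in> parcs G"
    if "u \<in> pverts G" "v \<in> pverts G" "x \<in> L' u" "y \<in> L' v" "(x, y) \<in> parcs H'" for u v x y
  proof -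
    from that obtain a b where "x = f a" "y = f b" "a \<in> L u" "b \<in> L v" by (auto simp: L'_def)
    with that show ?thesis using E[of u v a b] H'_iff[of a b] LV by auto
  qed
  moreover have "matching_between H' (L' u) (L' v)" if uv: "(u, v) \<in> parcs G" for u v
  proof -
    have *: "\<exists>a b. e = (f a, f b) \<and> (a, b) \<in> parcs H \<inter> L u \<times> L v \<and> a \<in> pverts H \<and> b \<in> pverts H"
      if "e \<in> parcs H' \<inter> L' u \<times> L' v" for e
    proof -
      from that obtain a b where ab: "e = (f a, f b)" "a \<in> L u" "b \<in> L v" "u \<in> pverts G" "v \<in> pverts G"
        by (auto simp: L'_def split: if_splits)
      with that show ?thesis using H'_iff[of a b] LV by blast
    qed
    show ?thesis
      unfolding matching_between_def
    proof (intro conjI inj_onI)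
      fix e e' assume e: "e \<in> parcs H' \<inter> L' u \<times> L' v" "e' \<in> parcs H' \<inter> L' u \<times> L' v"
      from *[OF e(1)] obtain a b where ab: "e = (f a, f b)" "(a, b) \<in> parcs H \<inter> L u \<times> L v"
        "a \<in> pverts H" "b \<in> pverts H" by blast
      from *[OF e(2)] obtain c d where cd: "e' = (f c, f d)" "(c, d) \<in> parcs H \<inter> L u \<times> L v"
        "c \<in> pverts H" "d \<in> pverts H" by blast
      have inj: "inj_on fst (parcs H \<inter> L u \<times> L v)" "inj_on snd (parcs H \<inter> L u \<times> L v)"
        using M[OF uv] by (auto simp: matching_between_def)
      show "e = e'" if "fst e = fst e'"
        using that ab cd f_eq inj_onD[OF inj(1) _ ab(2) cd(2)] by auto
      show "e = e'" if "snd e = snd e'"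
        using that ab cd f_eq inj_onD[OF inj(2) _ ab(2) cd(2)] by auto
    qed
  qed
  ultimately have "cover G L' H'" unfolding cover_def by blast
  moreover have "k \<le> card (L' v)" if "v \<in> pverts G" for v
  proof -
    have "inj_on f (L v)" using f LV that by (meson inj_on_subset subsetI)
    then show ?thesis using k[OF that] that by (simp add: L'_def card_image)
  qed
  ultimately have "cover_colorable G L' H'"
    using col unfolding correspondence_colorable_def by blast
  then obtain J where J: "independent_set H' J" "\<And>v. v \<in> pverts G \<Longrightarrow> J \<inter> L' v \<noteq> {}"
    unfolding cover_colorable_def cover_coloring_def by blast
  define I where "I = {x \<in> pverts H. f x \<in> J}"
  have "independent_set H I"
    using J(1) H'_iff unfolding independent_set_def I_def by blast
  moreover have "I \<inter> L v \<noteq> {}" if "v \<in> pverts G" for v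
    using J(2)[OF that] that LV by (auto simp: L'_def I_def)
  ultimately show ?thesis unfolding cover_colorable_def cover_coloring_def by blast
qed

text \<open>
  The least number in the definition of the correspondence chromatic number exists: greedily, lists
  of size at least the number of vertices always suffice.
\<close>

lemma correspondence_colorable_card:
  assumes G: "pair_graph G"
  shows "correspondence_colorable G (card (pverts G))"
  unfolding correspondence_colorable_def
proof (intro allI impI, elim conjE)
  fix L :: "'a \<Rightarrow> nat set" and H
  assume cov: "cover G L H" and k: "\<forall>v\<in>pverts G. card (pverts G) \<le> card (L v)"
  interpret G: pair_graph G by (rule G)
  from cov have H: "pair_graph H" and V: "pverts H = (\<Union>v\<in>pverts G. L v)"
    and E: "\<And>u v x y. \<lbrakk>u \<in> pverts G; v \<in> pverts G; x \<in> L u; y \<in> L v; (x, y) \<in> parcs H\<rbrakk>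
              \<Longrightarrow> (u, v) \<in> parcs G"
    and M: "\<And>u v. (u, v) \<in> parcs G \<Longrightarrow> matching_between H (L u) (L v)"
    unfolding cover_def by blast+
  interpret H: pair_graph H by (rule H)
  have "\<exists>I. finite I \<and> card I \<le> card S \<and> independent_set H I \<and> (\<forall>v\<in>S. I \<inter> L v \<noteq> {})"
    if "finite S" "S \<subseteq> pverts G" for S
    using that
  proof (induction S rule: finite_induct)
    case empty
    then show ?case by (auto simp: independent_set_def)
  next
    case (insert v S)
    then obtain I where I: "finite I" "card I \<le> card S" "independent_set H I"
      "\<forall>v\<in>S. I \<inter> L v \<noteq> {}" by auto
    have v: "v \<in> pverts G" using insert by auto
    define B where "B x = {y \<in> L v. (x, y) \<in> parcs H}" for x
    have B1: "card (B x) \<le> 1" "finite (B x)" if x: "x \<in> I" for x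
    proof -
      obtain u where u: "u \<in> pverts G" "x \<in> L u"
        using x I(3) V unfolding independent_set_def by auto
      have "y = z" if "y \<in> B x" "z \<in> B x" for y z
      proof -
        have "(u, v) \<in> parcs G" using that u v E by (auto simp: B_def)
        from M[OF this] have "inj_on fst (parcs H \<inter> L u \<times> L v)"
          by (simp add: matching_between_def)
        from inj_onD[OF this, of "(x, y)" "(x, z)"] show ?thesis
          using that u by (auto simp: B_def)
      qed
      then have "B x = {} \<or> (\<exists>y. B x = {y})" by blast
      then show "card (B x) \<le> 1" "finite (B x)" by auto
    qed
    have "card (\<Union>x\<in>I. B x) \<le> (\<Sum>x\<in>I. card (B x))"
      by (rule card_UN_le[OF I(1)])
    also have "\<dots> \<le> (\<Sum>x\<in>I. 1)" by (rule sum_mono) (use B1 in auto)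
    also have "\<dots> \<le> card S" using I by simp
    also have "\<dots> < card (insert v S)" using insert by simp
    also have "\<dots> \<le> card (pverts G)"
      using insert by (intro card_mono G.pair_finite_verts) auto
    also have "\<dots> \<le> card (L v)" using k v by auto
    finally have "\<not> L v \<subseteq> (\<Union>x\<in>I. B x)"
      using card_mono[of "\<Union>x\<in>I. B x" "L v"] I(1) B1 by auto
    then obtain y where y: "y \<in> L v" "\<And>x. x \<in> I \<Longrightarrow> (x, y) \<notin> parcs H"
      by (auto simp: B_def)
    have "independent_set H (insert y I)"
      unfolding independent_set_def
    proof (intro conjI ballI)
      show "insert y I \<subseteq> pverts H" using y(1) v V I(3) by (auto simp: independent_set_def)
      fix a b assume "a \<in> insert y I" "b \<in> insert y I"
      then show "(a, b) \<notin> parcs H"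
        using y(2) I(3) H.arcs_symmetric[of a b] H.no_loops'[of a b]
        by (auto simp: independent_set_def)
    qed
    moreover have "card (insert y I) \<le> card (insert v S)"
      using I insert by (simp add: card_insert_if)
    moreover have "\<forall>w\<in>insert v S. insert y I \<inter> L w \<noteq> {}" using I(4) y(1) by auto
    ultimately show ?case using I(1) by blast
  qed
  from this[OF G.pair_finite_verts] show "cover_colorable G L H"
    unfolding cover_colorable_def cover_coloring_def by blast
qed

lemma correspondence_chromatic_number_le_iff:
  assumes "pair_graph G"
  shows "correspondence_chromatic_number G \<le> k \<longleftrightarrow> correspondence_colorable G k"
proof
  have "correspondence_colorable G (correspondence_chromatic_number G)"
    unfolding correspondence_chromatic_number_def
    by (rule LeastI[of _ "card (pverts G)"]) (rule correspondence_colorable_card[OF assms])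
  moreover assume "correspondence_chromatic_number G \<le> k"
  ultimately show "correspondence_colorable G k"
    unfolding correspondence_colorable_def by (meson le_trans)
next
  assume "correspondence_colorable G k"
  then show "correspondence_chromatic_number G \<le> k"
    unfolding correspondence_chromatic_number_def by (rule Least_le)
qed

end

theory Submission
  imports Defs
begin

text \<open>
  The proof is a first-moment count in the style of Hurley and Pirot, without the local lemma. Let
  \<open>c(X)\<close> be the number of colorings of the subgraph induced by \<open>X\<close>, let \<open>D\<close> be the maximum degree,
  and suppose all lists have size at least \<open>k \<ge> 8 D / ln D\<close>. By induction on \<open>X\<close>,
  \<open>c(X + v) \<ge> sqrt D * c(X)\<close>, that is, a uniformly random coloring of \<open>X\<close> leaves on average at
  least \<open>sqrt D\<close> colors available at \<open>v\<close>. To see this, resample the colors of the neighbours of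
  \<open>v\<close>: as there are no triangles, they are independent and uniform on their available sets, given
  the rest. A neighbour \<open>u\<close> with at most one choice blocks at most one color of \<open>v\<close>, and this
  happens in at most \<open>c(X - u) \<le> c(X) / sqrt D\<close> colorings, which costs at most \<open>sqrt D\<close> colors in
  expectation. The neighbours with at least two choices leave at least
  \<open>k * exp (- 2 D / k) \<ge> 2 * sqrt D\<close> colors on average, by convexity.
\<close>

section \<open>Two estimates for the exponential function\<close>

text \<open>Take reciprocals in \<open>1 / (1 - t) = 1 + t / (1 - t) \<le> exp (2 * t)\<close>,
  where \<open>1 - t \<ge> 1 / 2\<close>. A neighbour with at least two available colors blocks a
  given color with probability \<open>t \<le> 1 / 2\<close>.\<close>

lemma exp_minus_double_le:
  fixes t :: real
  assumes "0 \<le> t" "t \<le> 1 / 2"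
  shows "exp (- (2 * t)) \<le> 1 - t"
proof -
  have "1 + t / (1 - t) \<le> exp (t / (1 - t))" by (rule exp_ge_add_one_self)
  also have "t / (1 - t) \<le> 2 * t"
  proof -
    have "t * 1 \<le> t * (2 * (1 - t))" using assms by (intro mult_left_mono) auto
    then show ?thesis using assms by (simp add: field_simps)
  qed
  finally have "1 + t / (1 - t) \<le> exp (2 * t)" by simp
  moreover have "1 + t / (1 - t) = 1 / (1 - t)" using assms by (simp add: field_simps)
  ultimately show ?thesis using assms by (simp add: exp_minus field_simps)
qed

text \<open>Jensen's inequality for the convex function \<open>exp\<close>: the average of
  \<open>m\<close> over \<open>P\<close> is at most \<open>D / card P\<close>.\<close>

lemma sum_exp_ge:
  fixes m :: "'a \<Rightarrow> real"
  assumes P: "finite P" and k: "0 < k" "k \<le> real (card P)"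
    and m: "(\<Sum>x\<in>P. m x) \<le> D" and D: "0 \<le> D"
  shows "k * exp (- (2 * D / k)) \<le> (\<Sum>x\<in>P. exp (- (2 * m x)))"
proof -
  let ?q = "real (card P)"
  have q: "0 < ?q" using k by linarith
  let ?e = "exp (- (2 * D / ?q))"
  \<comment> \<open>Both factors of \<open>q * exp (- (2 * D / q))\<close> increase with
    \<open>q\<close>, so \<open>k\<close> may be replaced by \<open>card P\<close>.\<close>
  have "D / ?q \<le> D / k" using k q D by (intro divide_left_mono) auto
  then have "k * exp (- (2 * D / k)) \<le> ?q * ?e" using k by (intro mult_mono) auto
  also have "\<dots> \<le> ?e * (?q + 2 * D - 2 * (\<Sum>x\<in>P. m x))"
    using m by (simp add: mult.commute)
  also have "\<dots> = (\<Sum>x\<in>P. ?e * (1 + (2 * D / ?q - 2 * m x)))"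
    using q by (simp add: sum.distrib sum_subtractf sum_distrib_left[symmetric])
  also have "\<dots> \<le> (\<Sum>x\<in>P. exp (- (2 * m x)))"
  proof (rule sum_mono) \<comment> \<open>tangent line at the average \<open>D / ?q\<close>\<close>
    fix x
    have "?e * (1 + (2 * D / ?q - 2 * m x)) \<le> ?e * exp (2 * D / ?q - 2 * m x)"
      by (intro mult_left_mono exp_ge_add_one_self) auto
    also have "\<dots> = exp (- (2 * m x))" by (simp add: exp_add[symmetric])
    finally show "?e * (1 + (2 * D / ?q - 2 * m x)) \<le> exp (- (2 * m x))" .
  qed
  finally show ?thesis .
qed

section \<open>Independent uniform choices at the neighbours of a vertex\<close>

lemma card_le_1_if_unique:
  assumes "\<And>x y. x \<in> A \<Longrightarrow> y \<in> A \<Longrightarrow> x = y"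
  shows "card A \<le> 1"
proof -
  have "A = {} \<or> (\<exists>x. A = {x})" using assms by blast
  then show ?thesis by auto
qed

text \<open>
  Here \<open>P\<close> is the list of \<open>v\<close>, \<open>N\<close> its set of colored neighbours, and \<open>A u\<close> the set of colors
  available at \<open>u\<close> once the coloring outside \<open>N\<close> is fixed.
\<close>

lemma sum_card_unblocked_ge:
  fixes A :: "'a \<Rightarrow> 'b set" and P :: "'c set"
  assumes N: "finite N" "real (card N) \<le> D"
    and A: "\<And>u. u \<in> N \<Longrightarrow> finite (A u)"
    and P: "finite P" and k: "0 < k" "k \<le> real (card P)"
    and matchP: "\<And>u x y y'. \<lbrakk>u \<in> N; x \<in> P; y \<in> A u; y' \<in> A u; (x, y) \<in> R; (x, y') \<in> R\<rbrakk> \<Longrightarrow> y = y'"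
    and matchA: "\<And>u x x' y. \<lbrakk>u \<in> N; x \<in> P; x' \<in> P; y \<in> A u; (x, y) \<in> R; (x', y) \<in> R\<rbrakk> \<Longrightarrow> x = x'"
  shows "real (card (PiE N A)) * (k * exp (- (2 * D / k)) - real (card {u \<in> N. card (A u) \<le> 1}))
    \<le> (\<Sum>f\<in>PiE N A. real (card {x \<in> P. \<forall>u\<in>N. (x, f u) \<notin> R}))"
proof (cases "\<exists>u\<in>N. A u = {}")
  case True
  then have "PiE N A = {}" by (auto simp: PiE_eq_empty_iff)
  then show ?thesis by simp
next
  case False
  \<comment> \<open>On \<open>B\<close> a color can be blocked with probability 1, so the
    exponential estimate fails there; these vertices are ignored first and charged one color each at
    the end.\<close>
  define B where "B = {u \<in> N. card (A u) \<le> 1}"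
  have B: "finite B" "B \<subseteq> N" using N by (auto simp: B_def)
  have A_pos: "0 < card (A u)" if "u \<in> N" for u
    using False A that by (auto simp: card_gt_0_iff)
  have finF: "finite (PiE N A)" using N A by (intro finite_PiE) auto
  \<comment> \<open>For \<open>u\<close> outside \<open>B\<close>, \<open>w x u\<close> is the
    probability that a uniform color from \<open>A u\<close> blocks \<open>x\<close>.\<close>
  define d where "d x u = real (card {y \<in> A u. (x, y) \<in> R})" for x u
  define w where "w x u = (if u \<in> B then 0 else d x u / real (card (A u)))" for x u
  \<comment> \<open>Double counting: each color in \<open>A u\<close> blocks at most one color of
    \<open>P\<close>.\<close>
  have w_sum: "(\<Sum>x\<in>P. w x u) \<le> 1" if u: "u \<in> N" for u
  proof (cases "u \<in> B")
    case False
    have "(\<Sum>x\<in>P. card {y \<in> A u. (x, y) \<in> R}) = (\<Sum>y\<in>A u. card {x \<in> P. (x, y) \<in> R})"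
      using P A[OF u] by (intro sum_multicount_gen) auto
    also have "\<dots> \<le> (\<Sum>y\<in>A u. 1)"
      using matchA[OF u] by (intro sum_mono card_le_1_if_unique) auto
    finally have "(\<Sum>x\<in>P. d x u) \<le> real (card (A u))"
      unfolding d_def of_nat_sum[symmetric] of_nat_le_iff by simp
    then show ?thesis
      using False A_pos[OF u] by (simp add: w_def sum_divide_distrib[symmetric])
  qed (simp add: w_def)
  have "(\<Sum>x\<in>P. \<Sum>u\<in>N. w x u) = (\<Sum>u\<in>N. \<Sum>x\<in>P. w x u)" by (rule sum.swap)
  also have "\<dots> \<le> (\<Sum>u\<in>N. 1)" by (intro sum_mono w_sum)
  finally have m: "(\<Sum>x\<in>P. \<Sum>u\<in>N. w x u) \<le> D" using N by simp
  have D0: "0 \<le> D" using N(2) of_nat_0_le_iff order_trans by blast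
  define S where "S f = {x \<in> P. \<forall>u\<in>N - B. (x, f u) \<notin> R}" for f
  have survive: "real (card (PiE N A)) * exp (- (2 * (\<Sum>u\<in>N. w x u)))
      \<le> real (card {f \<in> PiE N A. x \<in> S f})" if x: "x \<in> P" for x
  proof -
    \<comment> \<open>For fixed \<open>x\<close>, the choices \<open>f\<close> that leave
      \<open>x\<close> in \<open>S f\<close> again form a product set, so their number factorizes
      and can be bounded vertex by vertex.\<close>
    define A' where "A' u = (if u \<in> B then A u else {y \<in> A u. (x, y) \<notin> R})" for u
    have "{f \<in> PiE N A. x \<in> S f} = PiE N A'"
      using x B(2) by (fastforce simp: S_def A'_def PiE_iff split: if_splits)
    then have eq: "real (card {f \<in> PiE N A. x \<in> S f}) = (\<Prod>u\<in>N. real (card (A' u)))"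
      using N by (simp add: card_PiE)
    have "real (card (PiE N A)) * exp (- (2 * (\<Sum>u\<in>N. w x u)))
        = (\<Prod>u\<in>N. real (card (A u)) * exp (- (2 * w x u)))"
      using N by (simp add: card_PiE prod.distrib exp_sum[symmetric] sum_negf sum_distrib_left)
    also have "\<dots> \<le> (\<Prod>u\<in>N. real (card (A' u)))"
    proof (intro prod_mono conjI)
      fix u assume u: "u \<in> N"
      show "0 \<le> real (card (A u)) * exp (- (2 * w x u))" by simp
      show "real (card (A u)) * exp (- (2 * w x u)) \<le> real (card (A' u))"
      proof (cases "u \<in> B")
        case True
        then show ?thesis by (simp add: w_def A'_def)
      next
        case False
        then have a2: "2 \<le> card (A u)" using u by (auto simp: B_def)
        have d1: "d x u \<le> 1"
          using card_le_1_if_unique[of "{y \<in> A u. (x, y) \<in> R}"] matchP[OF u x]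
          by (auto simp: d_def)
        have "card (A u) = card {y \<in> A u. (x, y) \<in> R} + card {y \<in> A u. (x, y) \<notin> R}"
          using A[OF u] by (subst card_Un_disjoint[symmetric]) (auto intro: arg_cong[of _ _ card])
        then have A'd: "real (card (A' u)) = real (card (A u)) - d x u"
          using False by (simp add: A'_def d_def)
        have "d x u / real (card (A u)) \<le> 1 / 2"
          using a2 d1 by (simp add: field_simps)
        then have "exp (- (2 * w x u)) \<le> 1 - d x u / real (card (A u))"
          using False exp_minus_double_le[of "w x u"] by (simp add: w_def d_def)
        then have "real (card (A u)) * exp (- (2 * w x u))
            \<le> real (card (A u)) * (1 - d x u / real (card (A u)))"
          by (intro mult_left_mono) auto
        also have "\<dots> = real (card (A' u))" using A'd a2 by (simp add: right_diff_distrib)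
        finally show ?thesis .
      qed
    qed
    finally show ?thesis using eq by simp
  qed
  have "real (card (PiE N A)) * (k * exp (- (2 * D / k)))
      \<le> real (card (PiE N A)) * (\<Sum>x\<in>P. exp (- (2 * (\<Sum>u\<in>N. w x u))))"
    by (intro mult_left_mono sum_exp_ge P k m D0) auto
  also have "\<dots> \<le> (\<Sum>x\<in>P. real (card {f \<in> PiE N A. x \<in> S f}))"
    unfolding sum_distrib_left[where r = "real (card (PiE N A))"] by (intro sum_mono survive)
  also have "\<dots> = (\<Sum>f\<in>PiE N A. real (card (S f)))"
  proof -
    have "(\<Sum>x\<in>P. card {f \<in> PiE N A. x \<in> S f}) = (\<Sum>f\<in>PiE N A. card {x \<in> P. x \<in> S f})"
      using P finF by (intro sum_multicount_gen) auto
    moreover have "{x \<in> P. x \<in> S f} = S f" for f by (auto simp: S_def)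
    ultimately show ?thesis unfolding of_nat_sum[symmetric] by simp
  qed
  \<comment> \<open>Bringing \<open>B\<close> back removes at most one color of \<open>P\<close> for
    each of its vertices.\<close>
  also have "\<dots> \<le> (\<Sum>f\<in>PiE N A. real (card {x \<in> P. \<forall>u\<in>N. (x, f u) \<notin> R}) + real (card B))"
  proof (rule sum_mono)
    fix f assume f: "f \<in> PiE N A"
    let ?T = "{x \<in> P. \<forall>u\<in>N. (x, f u) \<notin> R}"
    have "S f \<subseteq> ?T \<union> (\<Union>u\<in>B. {x \<in> P. (x, f u) \<in> R})"
      by (auto simp: S_def)
    then have "card (S f) \<le> card (?T \<union> (\<Union>u\<in>B. {x \<in> P. (x, f u) \<in> R}))"
      using P B by (intro card_mono) auto
    also have "\<dots> \<le> card ?T + (\<Sum>u\<in>B. card {x \<in> P. (x, f u) \<in> R})"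
      by (rule order_trans[OF card_Un_le add_left_mono[OF card_UN_le[OF B(1)]]])
    also have "(\<Sum>u\<in>B. card {x \<in> P. (x, f u) \<in> R}) \<le> (\<Sum>u\<in>B. 1)"
    proof (intro sum_mono card_le_1_if_unique)
      fix u x x' assume "u \<in> B" "x \<in> {x \<in> P. (x, f u) \<in> R}" "x' \<in> {x \<in> P. (x, f u) \<in> R}"
      then show "x = x'" using matchA[of u x x' "f u"] B(2) f by auto
    qed
    finally show "real (card (S f)) \<le> real (card ?T) + real (card B)" by simp
  qed
  also have "\<dots> = (\<Sum>f\<in>PiE N A. real (card {x \<in> P. \<forall>u\<in>N. (x, f u) \<notin> R}))
      + real (card (PiE N A)) * real (card B)"
    by (simp add: sum.distrib)
  finally show ?thesis by (simp add: B_def algebra_simps)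
qed

section \<open>Colorings of induced subgraphs for a fixed cover\<close>

locale graph_cover = G: pair_graph G for G :: "'a pair_pre_digraph" +
  fixes L :: "'a \<Rightarrow> 'b set" and H :: "'b pair_pre_digraph"
  assumes cover: "cover G L H"
begin

sublocale H: pair_graph H
  using cover by (simp add: cover_def)

lemma verts_H: "pverts H = (\<Union>v\<in>pverts G. L v)"
  using cover by (simp add: cover_def)

lemma finite_list: "v \<in> pverts G \<Longrightarrow> finite (L v)"
  using H.pair_finite_verts verts_H by (auto intro: finite_subset)

lemma edge_H_imp_edge_G:
  "\<lbrakk>u \<in> pverts G; v \<in> pverts G; x \<in> L u; y \<in> L v; (x, y) \<in> parcs H\<rbrakk> \<Longrightarrow> (u, v) \<in> parcs G"
  using cover unfolding cover_def by blast

lemma matching_unique: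
  assumes "(u, v) \<in> parcs G"
  shows "\<lbrakk>x \<in> L u; y \<in> L v; y' \<in> L v; (x, y) \<in> parcs H; (x, y') \<in> parcs H\<rbrakk> \<Longrightarrow> y = y'"
    and "\<lbrakk>x \<in> L u; x' \<in> L u; y \<in> L v; (x, y) \<in> parcs H; (x', y) \<in> parcs H\<rbrakk> \<Longrightarrow> x = x'"
proof -
  have "matching_between H (L u) (L v)" using assms cover unfolding cover_def by blast
  then have inj: "inj_on fst (parcs H \<inter> L u \<times> L v)" "inj_on snd (parcs H \<inter> L u \<times> L v)"
    by (auto simp: matching_between_def)
  show "\<lbrakk>x \<in> L u; y \<in> L v; y' \<in> L v; (x, y) \<in> parcs H; (x, y') \<in> parcs H\<rbrakk> \<Longrightarrow> y = y'"
    using inj_onD[OF inj(1), of "(x, y)" "(x, y')"] by auto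
  show "\<lbrakk>x \<in> L u; x' \<in> L u; y \<in> L v; (x, y) \<in> parcs H; (x', y) \<in> parcs H\<rbrakk> \<Longrightarrow> x = x'"
    using inj_onD[OF inj(2), of "(x, y)" "(x', y)"] by auto
qed

text \<open>One color per vertex, and \<open>undefined\<close> outside \<open>X\<close>, so that
  each partial coloring is counted exactly once.\<close>

definition colorings :: "'a set \<Rightarrow> ('a \<Rightarrow> 'b) set" where
  "colorings X = {\<sigma> \<in> PiE X L. \<forall>u\<in>X. \<forall>w\<in>X. (\<sigma> u, \<sigma> w) \<notin> parcs H}"

text \<open>Only the values of \<open>\<sigma>\<close> on \<open>X\<close> matter, so a coloring of
  a larger set can be inserted without restricting it.\<close>

definition available :: "'a set \<Rightarrow> ('a \<Rightarrow> 'b) \<Rightarrow> 'a \<Rightarrow> 'b set" where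
  "available X \<sigma> v = {x \<in> L v. \<forall>w\<in>X. (x, \<sigma> w) \<notin> parcs H}"

lemma finite_colorings: "X \<subseteq> pverts G \<Longrightarrow> finite (colorings X)"
  unfolding colorings_def
  by (rule finite_subset[OF _ finite_PiE[of X L]])
    (auto intro: finite_subset[OF _ G.pair_finite_verts] finite_list)

lemma restrict_colorings: "\<lbrakk>\<sigma> \<in> colorings X; Y \<subseteq> X\<rbrakk> \<Longrightarrow> restrict \<sigma> Y \<in> colorings Y"
  by (auto simp: colorings_def)

lemma finite_available: "v \<in> pverts G \<Longrightarrow> finite (available X \<sigma> v)"
  unfolding available_def using finite_list by auto

lemma available_cong:
  "(\<And>w. w \<in> X \<Longrightarrow> \<sigma> w = \<tau> w) \<Longrightarrow> available X \<sigma> = available X \<tau>"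
  by (auto simp: available_def fun_eq_iff)

text \<open>Edges of \<open>H\<close> lie only over edges of \<open>G\<close>, so the colors on
  \<open>Z\<close> cannot block anything at \<open>v\<close>.\<close>

lemma available_Un_nonadjacent:
  assumes "\<sigma> \<in> colorings (Y \<union> Z)" "Y \<union> Z \<subseteq> pverts G" "v \<in> pverts G"
    and "\<And>w. w \<in> Z \<Longrightarrow> (v, w) \<notin> parcs G"
  shows "available (Y \<union> Z) \<sigma> v = available Y \<sigma> v"
proof -
  have "(x, \<sigma> w) \<notin> parcs H" if "x \<in> L v" "w \<in> Z" for x w
  proof -
    have "\<sigma> w \<in> L w" using assms(1) that by (auto simp: colorings_def)
    with that assms(2-4) edge_H_imp_edge_G[of v w x "\<sigma> w"] show ?thesis by blast
  qed
  then show ?thesis by (auto simp: available_def)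
qed

text \<open>The resampling identity. Since \<open>N\<close> is independent, its vertices do not
  constrain each other: given the coloring of \<open>Y\<close>, the extensions to \<open>N\<close>
  are exactly the free choices from the available sets.\<close>

lemma sum_colorings_Un:
  assumes sub: "Y \<union> N \<subseteq> pverts G" and disj: "Y \<inter> N = {}"
    and indep: "\<And>u w. \<lbrakk>u \<in> N; w \<in> N\<rbrakk> \<Longrightarrow> (u, w) \<notin> parcs G"
  shows "sum g (colorings (Y \<union> N))
    = (\<Sum>\<sigma>\<in>colorings Y. \<Sum>f\<in>PiE N (available Y \<sigma>). g (override_on \<sigma> f N))"
proof -
  have finN: "finite N" and finY: "finite Y"
    using sub by (auto intro: finite_subset[OF _ G.pair_finite_verts])
  have "(\<Sum>\<sigma>\<in>colorings Y. \<Sum>f\<in>PiE N (available Y \<sigma>). g (override_on \<sigma> f N))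
      = (\<Sum>(\<sigma>, f)\<in>(SIGMA \<sigma>:colorings Y. PiE N (available Y \<sigma>)). g (override_on \<sigma> f N))"
    using sub finN by (intro sum.Sigma finite_colorings ballI finite_PiE finite_available) auto
  also have "\<dots> = sum g (colorings (Y \<union> N))"
  proof (rule sum.reindex_bij_witness[where i = "\<lambda>\<rho>. (restrict \<rho> Y, restrict \<rho> N)"
        and j = "\<lambda>(\<sigma>, f). override_on \<sigma> f N"])
    fix a assume "a \<in> (SIGMA \<sigma>:colorings Y. PiE N (available Y \<sigma>))"
    then obtain \<sigma> f where a: "a = (\<sigma>, f)" "\<sigma> \<in> colorings Y" "f \<in> PiE N (available Y \<sigma>)" by auto
    have \<sigma>: "\<sigma> \<in> PiE Y L" using a by (auto simp: colorings_def)
    have fN: "f u \<in> L u" "w \<in> Y \<Longrightarrow> (f u, \<sigma> w) \<notin> parcs H" "w \<in> Y \<Longrightarrow> (\<sigma> w, f u) \<notin> parcs H"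
      if "u \<in> N" for u w
    proof -
      have "f u \<in> available Y \<sigma> u" using a(3) that by auto
      then show "f u \<in> L u" "w \<in> Y \<Longrightarrow> (f u, \<sigma> w) \<notin> parcs H" "w \<in> Y \<Longrightarrow> (\<sigma> w, f u) \<notin> parcs H"
        using H.arcs_symmetric[of "\<sigma> w" "f u"] by (auto simp: available_def)
    qed
    have ff: "(f u, f w) \<notin> parcs H" if "u \<in> N" "w \<in> N" for u w
      using edge_H_imp_edge_G[OF _ _ fN(1)[OF that(1)] fN(1)[OF that(2)]] indep[OF that] that sub
      by blast
    have "restrict (override_on \<sigma> f N) Y = \<sigma>"
      using \<sigma> disj by (auto simp: fun_eq_iff override_on_def PiE_iff extensional_def)
    moreover have "restrict (override_on \<sigma> f N) N = f"
      using a(3) by (auto simp: fun_eq_iff override_on_def PiE_iff extensional_def)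
    ultimately show "(\<lambda>\<rho>. (restrict \<rho> Y, restrict \<rho> N)) ((\<lambda>(\<sigma>, f). override_on \<sigma> f N) a) = a"
      using a by simp
    have "override_on \<sigma> f N \<in> PiE (Y \<union> N) L"
      using \<sigma> fN disj by (auto simp: override_on_def PiE_iff extensional_def)
    moreover have "(override_on \<sigma> f N u, override_on \<sigma> f N w) \<notin> parcs H"
      if "u \<in> Y \<union> N" "w \<in> Y \<union> N" for u w
      using that a(2) fN ff by (auto simp: override_on_def colorings_def)
    ultimately show "(\<lambda>(\<sigma>, f). override_on \<sigma> f N) a \<in> colorings (Y \<union> N)"
      using a by (simp add: colorings_def)
    show "g ((\<lambda>(\<sigma>, f). override_on \<sigma> f N) a) = (case a of (\<sigma>, f) \<Rightarrow> g (override_on \<sigma> f N))"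
      using a by simp
  next
    fix \<rho> assume \<rho>: "\<rho> \<in> colorings (Y \<union> N)"
    then show "(\<lambda>(\<sigma>, f). override_on \<sigma> f N) (restrict \<rho> Y, restrict \<rho> N) = \<rho>"
      by (auto simp: fun_eq_iff override_on_def colorings_def PiE_iff extensional_def)
    show "(restrict \<rho> Y, restrict \<rho> N) \<in> (SIGMA \<sigma>:colorings Y. PiE N (available Y \<sigma>))"
      using \<rho> by (auto simp: colorings_def available_def)
  qed
  finally show ?thesis by simp
qed

text \<open>Resampling the single vertex \<open>v\<close>: the inner sum is constant because
  \<open>g\<close> ignores the color of \<open>v\<close>.\<close>

lemma sum_colorings_insert:
  fixes g :: "('a \<Rightarrow> 'b) \<Rightarrow> nat"
  assumes sub: "insert v X \<subseteq> pverts G" and v: "v \<notin> X"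
    and g: "\<And>\<sigma> x. g (\<sigma>(v := x)) = g \<sigma>"
  shows "sum g (colorings (insert v X)) = (\<Sum>\<sigma>\<in>colorings X. card (available X \<sigma> v) * g \<sigma>)"
proof -
  have upd: "override_on \<sigma> f {v} = \<sigma>(v := f v)" for \<sigma> f :: "'a \<Rightarrow> 'b"
    by (auto simp: override_on_def fun_eq_iff)
  have "sum g (colorings (X \<union> {v}))
      = (\<Sum>\<sigma>\<in>colorings X. \<Sum>f\<in>PiE {v} (available X \<sigma>). g (override_on \<sigma> f {v}))"
    using sub v G.no_loops' by (intro sum_colorings_Un) auto
  also have "\<dots> = (\<Sum>\<sigma>\<in>colorings X. card (available X \<sigma> v) * g \<sigma>)"
    by (simp add: upd g card_PiE)
  finally show ?thesis by simp
qed

lemma card_colorings_insert: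
  assumes "insert v X \<subseteq> pverts G" "v \<notin> X"
  shows "card (colorings (insert v X)) = (\<Sum>\<sigma>\<in>colorings X. card (available X \<sigma> v))"
  using sum_colorings_insert[OF assms, of "\<lambda>_. 1"] by simp

text \<open>Each coloring of \<open>X\<close> has at most one extension to \<open>u\<close> that is
  counted here.\<close>

lemma card_few_available_le:
  assumes sub: "insert u X \<subseteq> pverts G" and u: "u \<notin> X"
  shows "card {\<sigma> \<in> colorings (insert u X). card (available X \<sigma> u) \<le> 1} \<le> card (colorings X)"
proof -
  have "available X (\<sigma>(u := x)) = available X \<sigma>" for \<sigma> x
    using u by (intro available_cong) auto
  then have "(\<Sum>\<sigma>\<in>colorings (insert u X). of_bool (card (available X \<sigma> u) \<le> 1))
      = (\<Sum>\<sigma>\<in>colorings X. card (available X \<sigma> u) * of_bool (card (available X \<sigma> u) \<le> 1))"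
    by (intro sum_colorings_insert[OF sub u]) simp
  also have "\<dots> \<le> (\<Sum>\<sigma>\<in>colorings X. 1)" by (intro sum_mono) auto
  finally show ?thesis
    using finite_colorings[OF sub] by (simp add: sum.If_cases of_bool_def Int_def)
qed

section \<open>Growth of the number of colorings\<close>

text \<open>Strong induction on the size of \<open>X\<close>. Resampling the neighbours of
  \<open>v\<close> gives \<open>k * exp (- (2 * D / k))\<close> colors on average, minus the mean
  number of neighbours with few choices. The induction hypothesis bounds this loss by
  \<open>D / l\<close>, and \<open>bound\<close> leaves at least \<open>l\<close>.\<close>

lemma card_colorings_insert_ge:
  assumes tf: "triangle_free G"
    and deg: "\<And>v. v \<in> pverts G \<Longrightarrow> real (card {u. (v, u) \<in> parcs G}) \<le> D"
    and lists: "\<And>v. v \<in> pverts G \<Longrightarrow> k \<le> real (card (L v))"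
    and k: "0 < k" and l: "0 < l" and bound: "l + D / l \<le> k * exp (- (2 * D / k))"
    and sub: "insert v X \<subseteq> pverts G" and v: "v \<notin> X"
  shows "l * real (card (colorings X)) \<le> real (card (colorings (insert v X)))"
  using sub v
proof (induction "card X" arbitrary: X v rule: less_induct)
  case less
  let ?K = "k * exp (- (2 * D / k))"
  define N where "N = {u \<in> X. (v, u) \<in> parcs G}"
  define Y where "Y = X - N"
  have X: "X = Y \<union> N" "Y \<inter> N = {}" "N \<subseteq> X" by (auto simp: N_def Y_def)
  have fin: "finite X" "finite N"
    using less.prems by (auto simp: N_def intro: finite_subset[OF _ G.pair_finite_verts])
  have vG: "v \<in> pverts G" and XG: "X \<subseteq> pverts G" using less.prems by auto
  \<comment> \<open>Triangle-freeness enters here: two adjacent neighbours of \<open>v\<close> would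
    form a triangle with it.\<close>
  have indep: "(u, w) \<notin> parcs G" if "u \<in> N" "w \<in> N" for u w
    using that tf G.arcs_symmetric[of v w] unfolding triangle_free_def N_def by blast
  have "finite {u. (v, u) \<in> parcs G}"
    using G.in_arcsD2 by (auto intro: finite_subset[OF _ G.pair_finite_verts])
  then have "card N \<le> card {u. (v, u) \<in> parcs G}" by (intro card_mono) (auto simp: N_def)
  with deg[OF vG] have cardN: "real (card N) \<le> D" by linarith
  define few where "few \<sigma> = {u \<in> N. card (available Y \<sigma> u) \<le> 1}" for \<sigma>
  have "real (card (colorings X)) * ?K - (\<Sum>\<sigma>\<in>colorings X. real (card (few \<sigma>)))
      = (\<Sum>\<sigma>\<in>colorings (Y \<union> N). ?K - real (card (few \<sigma>)))"
    by (simp add: sum_subtractf X(1)[symmetric])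
  also have "\<dots> = (\<Sum>\<sigma>\<in>colorings Y. \<Sum>f\<in>PiE N (available Y \<sigma>).
      ?K - real (card (few (override_on \<sigma> f N))))"
    using XG X indep by (intro sum_colorings_Un) auto
  \<comment> \<open>\<open>few\<close> depends only on the colors on \<open>Y\<close>, so resampling
    \<open>N\<close> does not change it.\<close>
  also have "\<dots> = (\<Sum>\<sigma>\<in>colorings Y. real (card (PiE N (available Y \<sigma>))) * (?K - real (card (few \<sigma>))))"
  proof -
    have "available Y (override_on \<sigma> f N) = available Y \<sigma>" for \<sigma> f
      using X by (intro available_cong) (auto simp: override_on_def)
    then show ?thesis by (simp add: few_def)
  qed
  also have "\<dots> \<le> (\<Sum>\<sigma>\<in>colorings Y. \<Sum>f\<in>PiE N (available Y \<sigma>).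
      real (card {x \<in> L v. \<forall>u\<in>N. (x, f u) \<notin> parcs H}))"
    unfolding few_def
  proof (intro sum_mono sum_card_unblocked_ge fin cardN finite_available finite_list vG k lists)
    fix \<sigma> u x y y' assume "u \<in> N" "x \<in> L v" "y \<in> available Y \<sigma> u" "y' \<in> available Y \<sigma> u"
      "(x, y) \<in> parcs H" "(x, y') \<in> parcs H"
    then show "y = y'" using matching_unique(1)[of v u x y y'] by (auto simp: N_def available_def)
  next
    fix \<sigma> u x x' y assume "u \<in> N" "x \<in> L v" "x' \<in> L v" "y \<in> available Y \<sigma> u"
      "(x, y) \<in> parcs H" "(x', y) \<in> parcs H"
    then show "x = x'" using matching_unique(2)[of v u x x' y] by (auto simp: N_def available_def)
  qed (use X XG in auto)
  also have "\<dots> = (\<Sum>\<sigma>\<in>colorings Y. \<Sum>f\<in>PiE N (available Y \<sigma>).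
      real (card (available N (override_on \<sigma> f N) v)))"
    by (simp add: available_def)
  also have "\<dots> = (\<Sum>\<sigma>\<in>colorings (Y \<union> N). real (card (available N \<sigma> v)))"
    using XG X indep by (intro sum_colorings_Un[symmetric]) auto
  \<comment> \<open>No vertex of \<open>Y\<close> is adjacent to \<open>v\<close>, so only
    \<open>N\<close> can block colors at \<open>v\<close>.\<close>
  also have "\<dots> = (\<Sum>\<sigma>\<in>colorings X. real (card (available X \<sigma> v)))"
  proof (intro sum.cong)
    fix \<sigma> assume "\<sigma> \<in> colorings X"
    moreover have NY: "N \<union> Y = X" using X by blast
    ultimately have "available (N \<union> Y) \<sigma> v = available N \<sigma> v"
      using XG vG by (intro available_Un_nonadjacent) (auto simp: N_def Y_def)
    then show "real (card (available N \<sigma> v)) = real (card (available X \<sigma> v))"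
      by (simp add: NY)
  qed (simp add: X(1)[symmetric])
  also have "\<dots> = real (card (colorings (insert v X)))"
    using card_colorings_insert[OF less.prems] by simp
  finally have main: "real (card (colorings X)) * ?K - (\<Sum>\<sigma>\<in>colorings X. real (card (few \<sigma>)))
      \<le> real (card (colorings (insert v X)))" .
  have "l * (\<Sum>\<sigma>\<in>colorings X. real (card (few \<sigma>)))
      = (\<Sum>u\<in>N. l * real (card {\<sigma> \<in> colorings X. card (available Y \<sigma> u) \<le> 1}))"
  proof -
    have "(\<Sum>\<sigma>\<in>colorings X. card (few \<sigma>))
        = (\<Sum>u\<in>N. card {\<sigma> \<in> colorings X. card (available Y \<sigma> u) \<le> 1})"
      unfolding few_def using finite_colorings[OF XG] fin by (intro sum_multicount_gen) auto
    then show ?thesis unfolding of_nat_sum[symmetric] sum_distrib_left[symmetric] by simp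
  qed
  also have "\<dots> \<le> (\<Sum>u\<in>N. real (card (colorings X)))"
  proof (rule sum_mono)
    fix u assume u: "u \<in> N"
    define X' where "X' = X - {u}"
    have X': "X = insert u X'" "u \<notin> X'" "X' = Y \<union> (N - {u})" using u X by (auto simp: X'_def)
    \<comment> \<open>The other vertices of \<open>N\<close> are not adjacent to \<open>u\<close>,
      so \<open>Y\<close> may be replaced by all of \<open>X - {u}\<close>, as
      \<open>card_few_available_le\<close> requires.\<close>
    have avail: "available X' \<sigma> u = available Y \<sigma> u" if "\<sigma> \<in> colorings X" for \<sigma>
    proof -
      have "available X' \<sigma> u = available X' (restrict \<sigma> X') u"
        by (intro fun_cong[OF available_cong]) auto
      also have "\<dots> = available Y (restrict \<sigma> X') u"
        unfolding X'(3)
      proof (rule available_Un_nonadjacent)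
        show "restrict \<sigma> (Y \<union> (N - {u})) \<in> colorings (Y \<union> (N - {u}))"
          using X by (intro restrict_colorings[OF that]) blast
      qed (use u X XG indep in auto)
      also have "\<dots> = available Y \<sigma> u"
        using X'(3) by (intro fun_cong[OF available_cong]) auto
      finally show ?thesis .
    qed
    have "card {\<sigma> \<in> colorings X. card (available Y \<sigma> u) \<le> 1}
        = card {\<sigma> \<in> colorings X. card (available X' \<sigma> u) \<le> 1}"
      using avail by (intro arg_cong[of _ _ card]) auto
    also have "\<dots> \<le> card (colorings X')"
      using card_few_available_le[of u X'] X' XG by auto
    finally have "l * real (card {\<sigma> \<in> colorings X. card (available Y \<sigma> u) \<le> 1})
        \<le> l * real (card (colorings X'))" using l by simp
    \<comment> \<open>The induction hypothesis, for adding \<open>u\<close> to the smaller set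
      \<open>X'\<close>.\<close>
    also have "\<dots> \<le> real (card (colorings (insert u X')))"
      using X' XG fin by (intro less.hyps) auto
    finally show "l * real (card {\<sigma> \<in> colorings X. card (available Y \<sigma> u) \<le> 1})
        \<le> real (card (colorings X))" using X' by simp
  qed
  also have "\<dots> \<le> D * real (card (colorings X))"
    using cardN by (simp add: mult_right_mono)
  finally have "(\<Sum>\<sigma>\<in>colorings X. real (card (few \<sigma>))) \<le> D / l * real (card (colorings X))"
    using l by (simp add: field_simps)
  moreover have "(l + D / l) * real (card (colorings X)) \<le> ?K * real (card (colorings X))"
    using bound by (intro mult_right_mono) auto
  ultimately show ?case using main by (simp add: algebra_simps)
qed

lemma cover_colorable_if_coloring:
  assumes "\<sigma> \<in> colorings (pverts G)"
  shows "cover_colorable G L H"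
proof -
  have "cover_coloring G L H (\<sigma> ` pverts G)"
    using assms unfolding cover_coloring_def independent_set_def colorings_def
    by (auto simp: verts_H PiE_iff)
  then show ?thesis by (auto simp: cover_colorable_def)
qed

text \<open>The empty set has exactly one coloring, and each added vertex multiplies the count by at
  least \<open>l > 0\<close>, so it never drops to zero.\<close>

lemma cover_colorable_if_growth:
  assumes "\<And>v X. \<lbrakk>insert v X \<subseteq> pverts G; v \<notin> X\<rbrakk>
      \<Longrightarrow> l * real (card (colorings X)) \<le> real (card (colorings (insert v X)))"
    and "0 < l"
  shows "cover_colorable G L H"
proof -
  have "0 < card (colorings X)" if "finite X" "X \<subseteq> pverts G" for X
    using that
  proof (induction X rule: finite_induct)
    case empty
    then show ?case by (simp add: colorings_def)
  next
    case (insert v X)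
    then have "0 < l * real (card (colorings X))" using \<open>0 < l\<close> by simp
    with assms(1)[of v X] insert show ?case by (simp add: less_le_trans)
  qed
  from this[OF G.pair_finite_verts] obtain \<sigma> where "\<sigma> \<in> colorings (pverts G)"
    by (auto simp: card_gt_0_iff)
  then show ?thesis by (rule cover_colorable_if_coloring)
qed

end

section \<open>Maximum degree and choice of the constants\<close>

lemma card_neighbours_le_max_degree:
  assumes "pair_graph G" "v \<in> pverts G"
  shows "card {u. (v, u) \<in> parcs G} \<le> max_degree G"
proof -
  interpret pair_graph G by (rule assms)
  have "{u. (v, u) \<in> parcs G} = snd ` out_arcs (with_proj G) v"
    by (force simp: out_arcs_def)
  moreover have "finite (out_arcs (with_proj G) v)"
    using pair_finite_arcs by (simp add: out_arcs_def)
  ultimately have "card {u. (v, u) \<in> parcs G} \<le> out_degree (with_proj G) v"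
    by (simp add: out_degree_def card_image_le)
  also have "\<dots> \<le> max_degree G"
    unfolding max_degree_def using assms(2) pair_finite_verts by (intro Max_ge) auto
  finally show ?thesis .
qed

text \<open>This is \<open>bound\<close> for \<open>l = sqrt D\<close>, where the left side is
  \<open>2 * sqrt D\<close>. The exponential is at least \<open>D powr (- 1 / 4)\<close>, and
  \<open>ln D \<le> 4 * D powr (1 / 4)\<close> gives
  \<open>k \<ge> 2 * D powr (3 / 4)\<close>.\<close>

lemma list_size_suffices:
  fixes D k :: real
  assumes D: "2 \<le> D" and k: "8 * (D / ln D) \<le> k"
  shows "sqrt D + D / sqrt D \<le> k * exp (- (2 * D / k))"
proof -
  have lnD: "0 < ln D" using D by simp
  have k0: "0 < k" using k D lnD by (smt (verit) divide_pos_pos)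
  \<comment> \<open>Apply \<open>ln y < y\<close> to the fourth root \<open>y\<close> of
    \<open>D\<close>.\<close>
  have "ln D / 4 = ln (D powr (1 / 4))" using D by (simp add: ln_powr)
  also have "\<dots> \<le> D powr (1 / 4)" using D by (intro less_imp_le ln_less_self) simp
  finally have ln_le: "ln D \<le> 4 * D powr (1 / 4)" by simp
  have "8 * D \<le> k * ln D" using k lnD by (simp add: field_simps)
  then have "2 * D / k \<le> ln D / 4" using k0 by (simp add: field_simps)
  then have e: "D powr (- 1 / 4) \<le> exp (- (2 * D / k))" using D by (simp add: powr_def)
  have pw: "D = D powr (1/2) * D powr (1/4) * D powr (1/4)"
    using D by (simp add: powr_add[symmetric])
  have pw': "D powr (1/4) * D powr (-1/4) = 1" using D by (simp add: powr_add[symmetric])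
  have "sqrt D + D / sqrt D = 2 * D powr (1/2)"
    using D by (simp add: real_div_sqrt powr_half_sqrt)
  also have "\<dots> = 8 * (D powr (1/2) * D powr (1/4) * D powr (1/4) / (4 * D powr (1/4))) * D powr (-1/4)"
    using pw' D by (simp add: field_simps)
  also have "\<dots> = 8 * (D / (4 * D powr (1/4))) * D powr (-1/4)"
    by (simp only: pw[symmetric])
  also have "\<dots> \<le> 8 * (D / ln D) * D powr (-1/4)"
    using ln_le lnD D by (intro mult_right_mono mult_left_mono divide_left_mono) auto
  also have "\<dots> \<le> k * exp (- (2 * D / k))"
    using k e k0 by (intro mult_mono) auto
  finally show ?thesis .
qed

theorem theorem1p7:
  shows "\<exists>C::real. C > 0 \<and>
    (\<forall>G :: 'a pair_pre_digraph.
       pair_graph G \<and> triangle_free G \<and> max_degree G \<ge> 2 \<longrightarrow>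
       real (correspondence_chromatic_number G)
         \<le> C * (real (max_degree G) / ln (real (max_degree G))))"
proof (intro exI[of _ 9] conjI allI impI)
  fix G :: "'a pair_pre_digraph"
  assume G: "pair_graph G \<and> triangle_free G \<and> max_degree G \<ge> 2"
  define D where "D = real (max_degree G)"
  \<comment> \<open>Since \<open>D / ln D \<ge> 1\<close>, the gap between the constants 8 and 9
    absorbs the rounding.\<close>
  define k where "k = nat \<lfloor>9 * (D / ln D)\<rfloor>"
  have D: "2 \<le> D" using G by (simp add: D_def)
  then have "ln D \<le> D" using ln_less_self[of D] by linarith
  then have "1 \<le> D / ln D" using D by (simp add: le_divide_eq)
  then have k: "8 * (D / ln D) \<le> real k" "real k \<le> 9 * (D / ln D)"
    unfolding k_def by linarith+
  have k0: "0 < real k" using k \<open>1 \<le> D / ln D\<close> by linarith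
  have "correspondence_colorable G k"
    unfolding correspondence_colorable_def
  proof (intro allI impI, elim conjE)
    fix L :: "'a \<Rightarrow> nat set" and H
    assume cov: "cover G L H" and lists: "\<forall>v\<in>pverts G. k \<le> card (L v)"
    interpret graph_cover G L H
      using G cov by (simp add: graph_cover_def graph_cover_axioms_def)
    show "cover_colorable G L H"
    proof (rule cover_colorable_if_growth)
      fix v X assume "insert v X \<subseteq> pverts G" "v \<notin> X"
      then show "sqrt D * real (card (colorings X)) \<le> real (card (colorings (insert v X)))"
        using G D lists k0 list_size_suffices[OF D k(1)] card_neighbours_le_max_degree[of G]
        by (intro card_colorings_insert_ge[where D = D and k = "real k"]) (auto simp: D_def)
    qed (use D in simp)
  qed
  then have "correspondence_chromatic_number G \<le> k"
    using correspondence_chromatic_number_le_iff G by blast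
  then show "real (correspondence_chromatic_number G)
      \<le> 9 * (real (max_degree G) / ln (real (max_degree G)))"
    using k(2) unfolding D_def by linarith
qed simp

end
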